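(* For the Grover walk started in $|0,R\rangle$ with absorbing boundaries at $-1$ and $N$, the left absorbing probability satisfies $$\lim_{N\to\infty}P_{\underline{-1,0,N}}(0,0,1)=\frac1{\sqrt2}.$$
   Context: The Grover walk acts on the Hilbert space $\mathcal H=\ell^2(\mathbb Z)\otimes\mathbb C^3$ with orthonormal basis $|m,c\rangle=|m\rangle\otimes|c\rangle$, $m\in\mathbb Z$, $c\in\{L,S,R\}$. The evolution operator is $U=\mathrm{Sh}\cdot(I\otimes G)$, where, in the ordered basis $(L,S,R)$, $G=\frac13\begin{pmatrix}-1&2&2\\2&-1&2\\2&2&-1\end{pmatrix}$, and the shift is $\mathrm{Sh}|m,L\rangle=|m-1,L\rangle$, $\mathrm{Sh}|m,S\rangle=|m,S\rangle$, $\mathrm{Sh}|m,R\rangle=|m+1,R\rangle$. For $n\in\mathbb Z$, $\Pi_{yes}^{n}=|n\rangle\langle n|\otimes I$ and $\Pi_{no}^{n}=I-\Pi_{yes}^{n}$. Two-boundary process with boundaries $-M<0<N$: start in $\psi_0=\alpha|0,L\rangle+\beta|0,S\rangle+\gamma|0,R\rangle$ (unit vector); at each step apply $U$, measure $\{\Pi_{yes}^{-M},\Pi_{no}^{-M}\}$, then measure $\{\Pi_{yes}^{N},\Pi_{no}^{N}\}$, stopping when either outcome is "yes". The left absorbing probability is, for $M,N\ge1$, $$P_{\underline{-M,0,N}}(\alpha,\beta,\gamma)=\sum_{t\ge1}\big\|\Pi_{yes}^{-M}U(\Pi_{no}^{N}\Pi_{no}^{-M}U)^{t-1}\psi_0\big\|^2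 .$$ *)

theory Defs
  imports "HOL-Analysis.Analysis"
begin

datatype coin = cL | cS | cR

lemma UNIV_coin: "(UNIV :: coin set) = {cL, cS, cR}"
  using coin.exhaust by blast

instance coin :: finite
  by standard (simp add: UNIV_coin)

text \<open>
  A vector \<open>\<psi>\<close> of \<open>\<ell>\<^sup>2(\<int>) \<otimes> \<complex>\<^sup>3\<close> is represented by its amplitudes \<open>\<psi> (m, c)\<close> in the basis
  \<open>|m, c\<rangle>\<close>. The type also contains functions that are not square-summable; the operators below
  are given by their pointwise formulas and map square-summable vectors to square-summable vectors
  (\<open>l2_evol\<close>, \<open>l2_proj_yes\<close>, \<open>l2_proj_no\<close>).
\<close>

type_synonym wave = "int \<times> coin \<Rightarrow> complex"

definition l2 :: "wave set" where
  "l2 = {\<psi>. (\<lambda>x. (cmod (\<psi> x))\<^sup>2) summable_on UNIV}"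

definition l2_norm :: "wave \<Rightarrow> real" where
  "l2_norm \<psi> = sqrt (\<Sum>\<^sub>\<infinity>x. (cmod (\<psi> x))\<^sup>2)"

definition ket :: "int \<Rightarrow> coin \<Rightarrow> wave" where
  "ket m c = (\<lambda>x. if x = (m, c) then 1 else 0)"

definition grover :: "coin \<Rightarrow> coin \<Rightarrow> complex" where
  "grover c d = (if c = d then - 1 / 3 else 2 / 3)"

definition coin_op :: "wave \<Rightarrow> wave" where
  "coin_op \<psi> = (\<lambda>(m, c). \<Sum>d\<in>UNIV. grover c d * \<psi> (m, d))"

text \<open>
  In amplitudes, the shift reads off the value at the preimage of the site; its action on the basis
  is \<open>shift_ket\<close>.
\<close>

primrec step_of :: "coin \<Rightarrow> int" where
  "step_of cL = - 1"
| "step_of cS = 0"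
| "step_of cR = 1"

definition shift :: "wave \<Rightarrow> wave" where
  "shift \<psi> = (\<lambda>(m, c). \<psi> (m - step_of c, c))"

definition evol :: "wave \<Rightarrow> wave" where
  "evol \<psi> = shift (coin_op \<psi>)"

definition proj_yes :: "int \<Rightarrow> wave \<Rightarrow> wave" where
  "proj_yes n \<psi> = (\<lambda>(m, c). if m = n then \<psi> (m, c) else 0)"

definition proj_no :: "int \<Rightarrow> wave \<Rightarrow> wave" where
  "proj_no n \<psi> = (\<lambda>x. \<psi> x - proj_yes n \<psi> x)"

definition start :: "complex \<Rightarrow> complex \<Rightarrow> complex \<Rightarrow> wave" where
  "start \<alpha> \<beta> \<gamma> = (\<lambda>x. \<alpha> * ket 0 cL x + \<beta> * ket 0 cS x + \<gamma> * ket 0 cR x)"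

text \<open>
  \<open>left_absorb M N \<alpha> \<beta> \<gamma>\<close> has boundaries at \<open>- M\<close> and \<open>N\<close>, for \<open>M, N \<ge> 1\<close>. The series always
  converges (\<open>left_absorb_summable\<close>).
\<close>

definition left_absorb :: "nat \<Rightarrow> nat \<Rightarrow> complex \<Rightarrow> complex \<Rightarrow> complex \<Rightarrow> real" where
  "left_absorb M N \<alpha> \<beta> \<gamma> =
     (\<Sum>\<^sub>\<infinity>t\<in>{1..}. (l2_norm (proj_yes (- int M) (evol
        (((\<lambda>\<phi>. proj_no (int N) (proj_no (- int M) (evol \<phi>))) ^^ (t - 1)) (start \<alpha> \<beta> \<gamma>)))))\<^sup>2)"


subsection \<open>The operators on basis vectors and on square-summable vectors\<close>

lemma shift_ket: "shift (ket m c) = ket (m + step_of c) c"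
  by (auto simp: shift_def ket_def fun_eq_iff)

lemma coin_op_ket: "coin_op (ket m c) = (\<lambda>x. \<Sum>d\<in>UNIV. grover d c * ket m d x)"
proof
  fix x :: "int \<times> coin"
  obtain n e where x: "x = (n, e)" by (cases x)
  show "coin_op (ket m c) x = (\<Sum>d\<in>UNIV. grover d c * ket m d x)"
    by (cases c; cases e) (auto simp: x coin_op_def ket_def UNIV_coin)
qed

lemma proj_yes_ket: "proj_yes n (ket m c) = (if m = n then ket m c else (\<lambda>_. 0))"
  by (auto simp: proj_yes_def ket_def fun_eq_iff)

lemma l2_normsq: "(l2_norm \<psi>)\<^sup>2 = (\<Sum>\<^sub>\<infinity>x. (cmod (\<psi> x))\<^sup>2)"
  by (simp add: l2_norm_def infsum_nonneg)

lemma has_sum_coin_iff: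
  fixes F :: "int \<times> coin \<Rightarrow> real"
  assumes nn: "\<And>x. 0 \<le> F x"
  shows "(F has_sum s) UNIV \<longleftrightarrow> ((\<lambda>m. \<Sum>c\<in>UNIV. F (m, c)) has_sum s) UNIV"
proof -
  have inner: "((\<lambda>c. F (m, c)) has_sum (\<Sum>c\<in>UNIV. F (m, c))) UNIV" for m
    by (rule has_sum_finite) simp
  have UU: "(UNIV :: (int \<times> coin) set) = Sigma UNIV (\<lambda>_. UNIV)" by simp
  show ?thesis
  proof
    assume "(F has_sum s) UNIV"
    then have "(F has_sum s) (Sigma UNIV (\<lambda>_. UNIV))"
      by (simp only: UU)
    then show "((\<lambda>m. \<Sum>c\<in>UNIV. F (m, c)) has_sum s) UNIV"
      by (rule has_sum_SigmaD) (rule inner)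
  next
    assume g: "((\<lambda>m. \<Sum>c\<in>UNIV. F (m, c)) has_sum s) UNIV"
    have "F summable_on Sigma UNIV (\<lambda>_. UNIV)"
      by (rule summable_on_SigmaI[OF inner has_sum_imp_summable[OF g]]) (simp add: nn)
    then have "(F has_sum s) (Sigma UNIV (\<lambda>_. UNIV))"
      by (rule has_sum_SigmaI[OF inner g])
    then show "(F has_sum s) UNIV"
      by (simp only: UU)
  qed
qed

lemma grover_isometry:
  fixes v :: "coin \<Rightarrow> complex"
  shows "(\<Sum>c\<in>UNIV. (cmod (\<Sum>d\<in>UNIV. grover c d * v d))\<^sup>2) = (\<Sum>c\<in>UNIV. (cmod (v c))\<^sup>2)"
  unfolding cmod_power2 by (simp add: UNIV_coin grover_def field_simps power2_eq_square)

lemma has_sum_coin_op: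
  assumes "((\<lambda>x. (cmod (\<psi> x))\<^sup>2) has_sum s) UNIV"
  shows "((\<lambda>x. (cmod (coin_op \<psi> x))\<^sup>2) has_sum s) UNIV"
  using assms by (simp add: has_sum_coin_iff coin_op_def grover_isometry)

lemma has_sum_shift:
  assumes "((\<lambda>x. (cmod (\<psi> x))\<^sup>2) has_sum s) UNIV"
  shows "((\<lambda>x. (cmod (shift \<psi> x))\<^sup>2) has_sum s) UNIV"
proof -
  let ?h = "\<lambda>(m, c). (m - step_of c, c)"
  have bij: "bij_betw ?h UNIV UNIV"
    by (rule bij_betw_byWitness[where f' = "\<lambda>(m, c). (m + step_of c, c)"]) auto
  have "((\<lambda>x. (cmod (\<psi> (?h x)))\<^sup>2) has_sum s) UNIV"
    using assms has_sum_reindex_bij_betw[OF bij, of "\<lambda>x. (cmod (\<psi> x))\<^sup>2" s] by simp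
  then show ?thesis
    by (simp add: shift_def split_def)
qed

lemma has_sum_evol:
  assumes "((\<lambda>x. (cmod (\<psi> x))\<^sup>2) has_sum s) UNIV"
  shows "((\<lambda>x. (cmod (evol \<psi> x))\<^sup>2) has_sum s) UNIV"
  unfolding evol_def by (intro has_sum_shift has_sum_coin_op assms)

lemma l2_evol: "\<psi> \<in> l2 \<Longrightarrow> evol \<psi> \<in> l2"
  using has_sum_evol by (auto simp: l2_def summable_on_def)

lemma evol_isometry: "\<psi> \<in> l2 \<Longrightarrow> l2_norm (evol \<psi>) = l2_norm \<psi>"
  using has_sum_evol[THEN infsumI] has_sum_infsum by (fastforce simp: l2_def l2_norm_def)

lemma l2_proj_yes: "\<psi> \<in> l2 \<Longrightarrow> proj_yes n \<psi> \<in> l2"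
  unfolding l2_def
  by (auto simp: proj_yes_def split_def elim!: summable_on_comparison_test)

lemma l2_proj_no: "\<psi> \<in> l2 \<Longrightarrow> proj_no n \<psi> \<in> l2"
  unfolding l2_def
  by (auto simp: proj_no_def proj_yes_def split_def elim!: summable_on_comparison_test)

lemma proj_pythagoras:
  assumes "\<psi> \<in> l2"
  shows "(l2_norm \<psi>)\<^sup>2 = (l2_norm (proj_yes n \<psi>))\<^sup>2 + (l2_norm (proj_no n \<psi>))\<^sup>2"
proof -
  have "(\<lambda>x. (cmod (\<psi> x))\<^sup>2) = (\<lambda>x. (cmod (proj_yes n \<psi> x))\<^sup>2 + (cmod (proj_no n \<psi> x))\<^sup>2)"
    by (auto simp: proj_yes_def proj_no_def)
  then show ?thesis
    using l2_proj_yes[OF assms, of n] l2_proj_no[OF assms, of n]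
    by (simp add: l2_normsq l2_def infsum_add)
qed

lemma l2_start: "start \<alpha> \<beta> \<gamma> \<in> l2"
proof -
  have "(\<lambda>x. (cmod (start \<alpha> \<beta> \<gamma> x))\<^sup>2) summable_on {(0, cL), (0, cS), (0, cR)}"
    by (rule summable_on_finite) simp
  then show ?thesis
    unfolding l2_def mem_Collect_eq
    by (rule summable_on_cong_neutral[THEN iffD1, rotated -1]) (auto simp: start_def ket_def)
qed

lemma l2_norm_start:
  "(l2_norm (start \<alpha> \<beta> \<gamma>))\<^sup>2 = (cmod \<alpha>)\<^sup>2 + (cmod \<beta>)\<^sup>2 + (cmod \<gamma>)\<^sup>2"
proof -
  have "(\<Sum>\<^sub>\<infinity>x. (cmod (start \<alpha> \<beta> \<gamma> x))\<^sup>2) =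
      (\<Sum>\<^sub>\<infinity>x\<in>{(0, cL), (0, cS), (0, cR)}. (cmod (start \<alpha> \<beta> \<gamma> x))\<^sup>2)"
    by (rule infsum_cong_neutral) (auto simp: start_def ket_def)
  also have "\<dots> = (cmod \<alpha>)\<^sup>2 + (cmod \<beta>)\<^sup>2 + (cmod \<gamma>)\<^sup>2"
    by (simp add: start_def ket_def)
  finally show ?thesis by (simp add: l2_normsq)
qed

lemma left_absorb_summable:
  "(\<lambda>t. (l2_norm (proj_yes (- int M) (evol
      (((\<lambda>\<phi>. proj_no (int N) (proj_no (- int M) (evol \<phi>))) ^^ (t - 1)) (start \<alpha> \<beta> \<gamma>)))))\<^sup>2)
    summable_on {1..}"
proof -
  define W where "W = (\<lambda>\<phi>. proj_no (int N) (proj_no (- int M) (evol \<phi>)))"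
  define u where "u t = (W ^^ t) (start \<alpha> \<beta> \<gamma>)" for t
  define p where "p t = (l2_norm (proj_yes (- int M) (evol (u t))))\<^sup>2" for t
  have l2u: "u t \<in> l2" for t
    by (induction t) (auto simp: u_def W_def l2_start intro!: l2_proj_no l2_evol)
  have step: "p t \<le> (l2_norm (u t))\<^sup>2 - (l2_norm (u (Suc t)))\<^sup>2" for t
  proof -
    let ?e = "evol (u t)"
    have e: "?e \<in> l2" by (intro l2_evol l2u)
    have "(l2_norm (u t))\<^sup>2 = p t + (l2_norm (proj_no (- int M) ?e))\<^sup>2"
      using proj_pythagoras[OF e, of "- int M"] evol_isometry[OF l2u] by (simp add: p_def)
    moreover have "(l2_norm (proj_no (- int M) ?e))\<^sup>2 \<ge> (l2_norm (u (Suc t)))\<^sup>2"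
      using proj_pythagoras[OF l2_proj_no[OF e], of "- int M" "int N"]
      by (simp add: u_def W_def)
    ultimately show ?thesis by simp
  qed
  have bound: "(\<Sum>t<n. p t) \<le> (l2_norm (u 0))\<^sup>2 - (l2_norm (u n))\<^sup>2" for n
  proof (induction n)
    case (Suc n)
    then show ?case using step[of n] by simp
  qed simp
  have "summable p"
  proof (rule summableI_nonneg_bounded[where x = "(l2_norm (u 0))\<^sup>2"])
    show "0 \<le> p n" for n by (simp add: p_def)
    show "(\<Sum>t<n. p t) \<le> (l2_norm (u 0))\<^sup>2" for n
      using bound[of n] zero_le_power2[of "l2_norm (u n)"] by linarith
  qed
  then have "p summable_on UNIV"
    by (intro summable_nonneg_imp_summable_on) (auto simp: p_def)
  moreover have "bij_betw (\<lambda>t. t - 1) {1 :: nat..} UNIV"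
    by (rule bij_betw_byWitness[where f' = Suc]) auto
  ultimately have "(\<lambda>t. p (t - 1)) summable_on {1..}"
    using summable_on_reindex_bij_betw[of "\<lambda>t. t - 1" "{1 :: nat..}" UNIV p] by simp
  then show ?thesis
    by (simp add: p_def u_def W_def)
qed

end

theory Submission
  imports Defs "HOL-Complex_Analysis.Complex_Analysis"
begin

text \<open>
  Let \<open>b\<^sub>t\<close> be the amplitude arriving at \<open>|- 1, L\<rangle>\<close> at time \<open>t\<close>, so that the absorption probability
  is \<open>\<Sum>|b\<^sub>t|\<^sup>2\<close>. The generating function \<open>F(z) = \<Sum> b\<^sub>t z\<^sup>t\<close> is the reflection coefficient of \<open>N\<close>
  identical scatterers, a rational function given by a transfer matrix. On \<open>|z| = 1\<close> that matrix
  preserves, up to scaling, besides the flux \<open>|q|\<^sup>2 - |p|\<^sup>2\<close> a second Hermitian form, which yields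
  \<open>(3 Re z - 1) |F|\<^sup>2 = 2 Re F\<close>. Hence \<open>|F|\<^sup>2\<close> is the real part of
  \<open>K = (4zF - 3P(z\<^sup>2 - 1)) / (3z\<^sup>2 - 2z + 3)\<close> for every real \<open>P\<close>, and exactly one \<open>P\<close> cancels the poles
  of \<open>K\<close> on the circle. Parseval's identity and the mean value property then give
  \<open>\<Sum>|b\<^sub>t|\<^sup>2 = K(0) = P\<close>. At the two poles the recursion for \<open>F\<close> becomes \<open>x\<^sub>n\<^sub>+\<^sub>2 = 6x\<^sub>n\<^sub>+\<^sub>1 - x\<^sub>n\<close>, so
  \<open>P = 2U\<^sub>N/T\<^sub>N\<close> where \<open>(T\<^sub>N, U\<^sub>N)\<close> runs through the solutions of the Pell equation \<open>T\<^sup>2 - 8U\<^sup>2 = 1\<close>.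
\<close>

subsection \<open>The transfer recursion\<close>

text \<open>
  One site has the transfer matrix with rows \<open>(3 + z, - 2z(1 + z))\<close> and \<open>(2z(1 + z), - z\<^sup>2(3z + 1))\<close>,
  whose trace is \<open>- (z - 1)(3z\<^sup>2 + 4z + 3)\<close> and determinant \<open>z\<^sup>2(z - 1)\<^sup>2\<close>. By Cayley-Hamilton a factor
  \<open>z - 1\<close> splits off at each step, which leaves the recursion below. The common zero of numerator and
  denominator at \<open>z = 1\<close>, which is due to the trapped states of the walk, thereby disappears.
\<close>

fun refl_den :: "nat \<Rightarrow> complex poly" where
  "refl_den 0 = [:-1, 1:]"
| "refl_den (Suc 0) = [:3, 1:]"
| "refl_den (Suc (Suc n)) = - ([:3, 4, 3:] * refl_den (Suc n)) - [:0, 0, 1:] * refl_den n"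

fun refl_num :: "nat \<Rightarrow> complex poly" where
  "refl_num 0 = 0"
| "refl_num (Suc 0) = [:0, 2, 2:]"
| "refl_num (Suc (Suc n)) = - ([:3, 4, 3:] * refl_num (Suc n)) - [:0, 0, 1:] * refl_num n"

lemma poly_refl_den_rec:
  "poly (refl_den (Suc (Suc n))) z = - (3 + 4 * z + 3 * z\<^sup>2) * poly (refl_den (Suc n)) z - z\<^sup>2 * poly (refl_den n) z"
  by (simp add: algebra_simps power2_eq_square)

lemma poly_refl_num_rec:
  "poly (refl_num (Suc (Suc n))) z = - (3 + 4 * z + 3 * z\<^sup>2) * poly (refl_num (Suc n)) z - z\<^sup>2 * poly (refl_num n) z"
  by (simp add: algebra_simps power2_eq_square)

declare refl_den.simps(3) [simp del] refl_num.simps(3) [simp del]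

text \<open>Both sides are linear in the two sequences and so obey the same three-term recursion; it
  remains to compare them at \<open>n = 0\<close> and \<open>n = 1\<close>. At \<open>z = 1\<close>
  the identities say only that the two polynomials agree, so that point is treated separately
  below.\<close>

lemma transfer:
  "(z - 1) * poly (refl_den (Suc n)) z = (3 + z) * poly (refl_den n) z - 2 * z * (1 + z) * poly (refl_num n) z"
  "(z - 1) * poly (refl_num (Suc n)) z = 2 * z * (1 + z) * poly (refl_den n) z - z\<^sup>2 * (3 * z + 1) * poly (refl_num n) z"
proof (induction n rule: refl_den.induct)
  case 1
  show "(z - 1) * poly (refl_den (Suc 0)) z = (3 + z) * poly (refl_den 0) z - 2 * z * (1 + z) * poly (refl_num 0) z"
    "(z - 1) * poly (refl_num (Suc 0)) z = 2 * z * (1 + z) * poly (refl_den 0) z - z\<^sup>2 * (3 * z + 1) * poly (refl_num 0) z"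
    by (simp_all add: algebra_simps)
next
  case 2
  show "(z - 1) * poly (refl_den (Suc (Suc 0))) z =
      (3 + z) * poly (refl_den (Suc 0)) z - 2 * z * (1 + z) * poly (refl_num (Suc 0)) z"
    "(z - 1) * poly (refl_num (Suc (Suc 0))) z =
      2 * z * (1 + z) * poly (refl_den (Suc 0)) z - z\<^sup>2 * (3 * z + 1) * poly (refl_num (Suc 0)) z"
    by (simp_all add: poly_refl_den_rec poly_refl_num_rec algebra_simps power2_eq_square)
next
  case (3 n)
  show "(z - 1) * poly (refl_den (Suc (Suc (Suc n)))) z =
      (3 + z) * poly (refl_den (Suc (Suc n))) z - 2 * z * (1 + z) * poly (refl_num (Suc (Suc n))) z"
    unfolding poly_refl_den_rec[of "Suc n"] poly_refl_den_rec[of n] poly_refl_num_rec[of n]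
    using "3.IH"(1,3) unfolding poly_refl_den_rec[of n] by algebra
  show "(z - 1) * poly (refl_num (Suc (Suc (Suc n)))) z =
      2 * z * (1 + z) * poly (refl_den (Suc (Suc n))) z - z\<^sup>2 * (3 * z + 1) * poly (refl_num (Suc (Suc n))) z"
    unfolding poly_refl_num_rec[of "Suc n"] poly_refl_den_rec[of n] poly_refl_num_rec[of n]
    using "3.IH"(2,4) unfolding poly_refl_num_rec[of n] by algebra
qed

text \<open>If the one-site matrix M preserves the flux form H up to scaling, it also preserves H
  composed with any polynomial in M. The second form comes from the traceless part of M, normalised
  to be Hermitian, minus the multiple of H that makes it vanish on the initial vector, where
  \<open>p 0 = 0\<close>.\<close>

lemma invariant_forms:
  assumes z: "cmod z = 1" "z \<noteq> 1"
  defines "q n \<equiv> poly (refl_den n) z" and "p n \<equiv> poly (refl_num n) z"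
  shows "q n * cnj (q n) - p n * cnj (p n) = (z - 1) * cnj (z - 1)"
    and "2 * (q n * cnj (p n) + cnj (q n) * p n) = (3 * (z + cnj z) - 2) * (p n * cnj (p n))"
proof -
  \<comment> \<open>With the conjugate as a second variable tied to \<open>z\<close> by
    \<open>z * w = 1\<close>, each induction step is a polynomial identity.\<close>
  define w where "w = cnj z"
  have zw: "z * w = 1"
    using z(1) by (simp add: w_def complex_norm_square[symmetric])
  have w1: "w \<noteq> 1"
    using z(2) by (metis complex_cnj_cnj complex_cnj_one w_def)
  have nz: "(z - 1) * (w - 1) \<noteq> 0" using z(2) w1 by simp
  have step: "(z - 1) * q (Suc n) = (3 + z) * q n - 2 * z * (1 + z) * p n"
    "(z - 1) * p (Suc n) = 2 * z * (1 + z) * q n - z\<^sup>2 * (3 * z + 1) * p n" for n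
    using transfer unfolding p_def q_def by blast+
  have step': "(w - 1) * cnj (q (Suc n)) = (3 + w) * cnj (q n) - 2 * w * (1 + w) * cnj (p n)"
    "(w - 1) * cnj (p (Suc n)) = 2 * w * (1 + w) * cnj (q n) - w\<^sup>2 * (3 * w + 1) * cnj (p n)" for n
    using step[of n, THEN arg_cong[where f = cnj]] by (simp_all add: w_def)
  have a: "q n * cnj (q n) - p n * cnj (p n) = (z - 1) * (w - 1)"
  proof (induction n)
    case 0
    show ?case by (simp add: q_def p_def w_def algebra_simps)
  next
    case (Suc n)
    have "((z - 1) * (w - 1)) * (q (Suc n) * cnj (q (Suc n)) - p (Suc n) * cnj (p (Suc n)))
        = ((z - 1) * q (Suc n)) * ((w - 1) * cnj (q (Suc n)))
          - ((z - 1) * p (Suc n)) * ((w - 1) * cnj (p (Suc n)))"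
      by algebra
    also have "\<dots> = ((z - 1) * (w - 1)) * (q n * cnj (q n) - p n * cnj (p n))"
      unfolding step step' using zw by algebra
    finally show ?case using nz Suc by simp
  qed
  show "q n * cnj (q n) - p n * cnj (p n) = (z - 1) * cnj (z - 1)"
    using a by (simp add: w_def)
  have "2 * (q n * cnj (p n) + cnj (q n) * p n) = (3 * (z + w) - 2) * (p n * cnj (p n))"
  proof (induction n)
    case 0
    show ?case by (simp add: q_def p_def)
  next
    case (Suc n)
    let ?J = "\<lambda>n. 2 * (q n * cnj (p n) + cnj (q n) * p n) - (3 * (z + w) - 2) * (p n * cnj (p n))"
    have "((z - 1) * (w - 1)) * ?J (Suc n)
        = 2 * (((z - 1) * q (Suc n)) * ((w - 1) * cnj (p (Suc n)))
            + ((w - 1) * cnj (q (Suc n))) * ((z - 1) * p (Suc n)))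
          - (3 * (z + w) - 2) * (((z - 1) * p (Suc n)) * ((w - 1) * cnj (p (Suc n))))"
      by algebra
    also have "\<dots> = ((z - 1) * (w - 1)) * ?J n"
      unfolding step step' using zw by algebra
    finally show ?case using nz Suc by simp
  qed
  then show "2 * (q n * cnj (p n) + cnj (q n) * p n) = (3 * (z + cnj z) - 2) * (p n * cnj (p n))"
    by (simp add: w_def)
qed

subsection \<open>Parseval on circles\<close>

lemma has_integral_exp_2pi:
  fixes k :: int
  shows "((\<lambda>x. exp (2 * of_real pi * \<i> * of_int k * of_real x)) has_integral (if k = 0 then 1 else 0)) {0..1}"
proof (cases "k = 0")
  case True
  then show ?thesis using has_integral_const_real[of "1::complex" 0 1] by simp
next
  case False
  define c where "c = 2 * of_real pi * \<i> * of_int k"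
  have c: "c \<noteq> 0" using False by (simp add: c_def)
  have "((\<lambda>x. exp (c * of_real x)) has_integral exp (c * of_real 1) / c - exp (c * of_real 0) / c) {0..1}"
    using c by (intro fundamental_theorem_of_calculus)
      (auto intro!: derivative_eq_intros has_vector_derivative_real_field)
  moreover have "exp c = 1"
    unfolding c_def using exp_2pi_1_int[of k] by (simp add: mult_ac)
  ultimately show ?thesis using False by (simp add: c_def)
qed

lemma has_integral_circle_mean:
  assumes "K holomorphic_on cball 0 s" "0 < s"
  shows "((\<lambda>x. K (circlepath 0 s x)) has_integral K 0) {0..1}"
proof -
  have "((\<lambda>u. K u / (u - 0)) has_contour_integral 2 * of_real pi * \<i> * K 0) (circlepath 0 s)"
    using assms by (intro Cauchy_integral_circlepath_simple) auto
  then have "((\<lambda>x. K (circlepath 0 s x) * (2 * of_real pi * \<i>)) has_integral (K 0 * (2 * of_real pi * \<i>))) {0..1}"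
    using assms(2)
    unfolding has_contour_integral vector_derivative_circlepath
    by (simp add: circlepath mult_ac)
  from has_integral_mult_left[OF this, of "1 / (2 * of_real pi * \<i>)"] show ?thesis
    by simp
qed

text \<open>Expanding the square gives a double sum of characters, of which only the diagonal
  survives integration.\<close>

lemma has_integral_norm_poly_circle:
  "((\<lambda>x. (cmod (\<Sum>t<n. b t * (circlepath 0 s x)^t))\<^sup>2) has_integral
      (\<Sum>t<n. (cmod (b t))\<^sup>2 * s^(2*t))) {0..1}"
proof -
  define E :: "int \<Rightarrow> real \<Rightarrow> complex" where "E k x = exp (2 * of_real pi * \<i> * of_int k * of_real x)" for k x
  define c where "c t = b t * of_real s ^ t" for t
  have summand: "b t * (circlepath 0 s x)^t = c t * E (int t) x" for t x
    by (simp add: c_def E_def circlepath power_mult_distrib exp_of_nat_mult[symmetric] mult_ac)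
  have EE: "E i x * cnj (E j x) = E (i - j) x" for i j x
    by (simp add: E_def exp_cnj exp_add[symmetric] algebra_simps)
  have sq: "of_real ((cmod (\<Sum>t<n. b t * (circlepath 0 s x)^t))\<^sup>2) =
      (\<Sum>i<n. \<Sum>j<n. c i * cnj (c j) * E (int i - int j) x)" for x
    unfolding complex_norm_square summand cnj_sum sum_product
    by (simp add: EE[symmetric] mult_ac)
  have "((\<lambda>x. \<Sum>i<n. \<Sum>j<n. c i * cnj (c j) * E (int i - int j) x) has_integral
      (\<Sum>i<n. \<Sum>j<n. c i * cnj (c j) * (if int i - int j = 0 then 1 else 0))) {0..1}"
    unfolding E_def
    by (intro has_integral_sum has_integral_mult_right has_integral_exp_2pi) auto
  also have "(\<Sum>i<n. \<Sum>j<n. c i * cnj (c j) * (if int i - int j = 0 then 1 else 0)) = (\<Sum>i<n. c i * cnj (c i))"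
    by (intro sum.cong refl) (simp add: if_distrib sum.delta' cong: if_cong)
  also have "\<dots> = of_real (\<Sum>t<n. (cmod (b t))\<^sup>2 * s^(2*t))"
    unfolding of_real_sum
  proof (intro sum.cong refl)
    fix i
    have "c i * cnj (c i) = of_real ((cmod (c i))\<^sup>2)"
      by (simp only: complex_norm_square)
    also have "(cmod (c i))\<^sup>2 = (cmod (b i))\<^sup>2 * \<bar>s ^ i\<bar>\<^sup>2"
      by (simp add: c_def norm_mult norm_power power_mult_distrib power_abs)
    also have "\<bar>s ^ i\<bar>\<^sup>2 = s^(2*i)"
      by (simp only: power2_abs power_even_eq)
    finally show "c i * cnj (c i) = of_real ((cmod (b i))\<^sup>2 * s^(2*i))" .
  qed
  finally show ?thesis
    unfolding sq[symmetric] by - (drule has_integral_Re, simp only: Re_complex_of_real)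
qed

text \<open>Dominated convergence from the polynomial case: absolute convergence on the circle
  bounds all partial sums by one constant.\<close>

lemma parseval_circle:
  assumes sm: "summable (\<lambda>t. cmod (b t) * s^t)" and s: "0 \<le> s"
  defines "g \<equiv> \<lambda>x. (cmod (\<Sum>t. b t * (circlepath 0 s x)^t))\<^sup>2"
  shows "g integrable_on {0..1}" "(\<lambda>t. (cmod (b t))\<^sup>2 * s^(2*t)) sums integral {0..1} g"
proof -
  define f where "f n x = (cmod (\<Sum>t<n. b t * (circlepath 0 s x)^t))\<^sup>2" for n x
  have nrm: "cmod (b t * (circlepath 0 s x)^t) = cmod (b t) * s^t" for t x
    using s by (simp add: circlepath norm_mult norm_power)
  have int: "(f n has_integral (\<Sum>t<n. (cmod (b t))\<^sup>2 * s^(2*t))) {0..1}" for n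
    unfolding f_def by (rule has_integral_norm_poly_circle)
  have bnd: "norm (f n x) \<le> (\<Sum>t. cmod (b t) * s^t)\<^sup>2" for n x
  proof -
    have "cmod (\<Sum>t<n. b t * (circlepath 0 s x)^t) \<le> (\<Sum>t<n. cmod (b t) * s^t)"
      using norm_sum[of "\<lambda>t. b t * (circlepath 0 s x)^t" "{..<n}"] by (simp only: nrm)
    also have "\<dots> \<le> (\<Sum>t. cmod (b t) * s^t)"
      using s by (intro sum_le_suminf sm) auto
    finally show ?thesis by (simp add: f_def power_mono)
  qed
  have conv: "(\<lambda>n. f n x) \<longlonglongrightarrow> g x" for x
  proof -
    have "summable (\<lambda>t. b t * (circlepath 0 s x)^t)"
      by (rule summable_norm_cancel) (simp only: nrm sm)
    then show ?thesis
      unfolding f_def g_def by (intro tendsto_power tendsto_norm summable_LIMSEQ)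
  qed
  have 1: "f n integrable_on {0..1}" for n
    using int by (rule has_integral_integrable)
  have 2: "(\<lambda>x::real. (\<Sum>t. cmod (b t) * s^t)\<^sup>2) integrable_on {0..1}"
    by (rule integrable_const_ivl)
  show "g integrable_on {0..1}"
    by (rule dominated_convergence(1)[OF 1 2 bnd conv])
  have "(\<lambda>n. integral {0..1} (f n)) \<longlonglongrightarrow> integral {0..1} g"
    by (rule dominated_convergence(2)[OF 1 2 bnd conv])
  then show "(\<lambda>t. (cmod (b t))\<^sup>2 * s^(2*t)) sums integral {0..1} g"
    using int[THEN integral_unique] by (simp add: sums_def)
qed

text \<open>The power series is controlled only inside the disc, so Parseval and the mean value
  property are applied at radius \<open>s n\<close> < 1. As \<open>s n\<close> tends to 1, the mean
  of \<open>D\<close> tends to 0 because \<open>D\<close> is continuous on the closed disc and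
  vanishes on its boundary; Tannery's theorem handles the series.\<close>

lemma suminf_norm_sq_coeffs:
  assumes F: "continuous_on (cball 0 1) F" "\<And>z. cmod z < 1 \<Longrightarrow> (\<lambda>t. b t * z^t) sums F z"
    and K: "continuous_on (cball 0 1) K" "K holomorphic_on ball 0 1"
    and b: "\<And>t. cmod (b t) \<le> 1" "summable (\<lambda>t. (cmod (b t))\<^sup>2)"
    and circle: "\<And>z. cmod z = 1 \<Longrightarrow> (cmod (F z))\<^sup>2 = Re (K z)"
  shows "(\<Sum>t. (cmod (b t))\<^sup>2) = Re (K 0)"
proof -
  define D where "D z = (cmod (F z))\<^sup>2 - Re (K z)" for z
  define s where "s n = 1 - inverse (real (Suc (Suc n)))" for n
  have s: "0 < s n" "s n < 1" for n by (auto simp: s_def field_simps)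
  have s_lim: "s \<longlonglongrightarrow> 1" 
    unfolding s_def
    using LIMSEQ_Suc[OF LIMSEQ_inverse_real_of_nat_add_minus[of 1]] by simp
  have contD: "continuous_on (cball 0 1) D"
    unfolding D_def by (intro continuous_intros F K)
  have in_cball: "circlepath 0 (s n) x \<in> cball 0 1" for n x
    using s[of n] by (simp add: circlepath norm_mult)
  have mean: "((\<lambda>x. D (circlepath 0 (s n) x)) has_integral
      (\<Sum>t. (cmod (b t))\<^sup>2 * s n^(2*t)) - Re (K 0)) {0..1}" for n
  proof -
    let ?c = "circlepath 0 (s n)"
    have "summable (\<lambda>t. s n ^ t)" using s[of n] by (intro summable_geometric) auto
    then have sm: "summable (\<lambda>t. cmod (b t) * s n^t)"
      by (rule summable_comparison_test')
         (use s[of n] b(1) in \<open>auto simp: abs_mult mult_left_le_one_le\<close>)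
    have eq: "(\<Sum>t. b t * (?c x)^t) = F (?c x)" for x
      using F(2)[of "?c x"] s[of n] by (simp add: circlepath norm_mult sums_iff)
    have "((\<lambda>x. (cmod (F (?c x)))\<^sup>2) has_integral (\<Sum>t. (cmod (b t))\<^sup>2 * s n^(2*t))) {0..1}"
      using parseval_circle[OF sm] s[of n] unfolding eq
      by (simp add: sums_iff has_integral_integrable_integral)
    moreover have "((\<lambda>x. K (?c x)) has_integral K 0) {0..1}"
      using s[of n] by (intro has_integral_circle_mean holomorphic_on_subset[OF K(2)]) auto
    then have "((\<lambda>x. Re (K (?c x))) has_integral Re (K 0)) {0..1}"
      by (rule has_integral_Re)
    ultimately show ?thesis unfolding D_def by (rule has_integral_diff)
  qed
  obtain B where B: "norm (D z) \<le> B" if "z \<in> cball 0 1" for z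
    using compact_imp_bounded[OF compact_continuous_image[OF contD]] by (force simp: bounded_iff)
  have conv: "(\<lambda>n. D (circlepath 0 (s n) x)) \<longlonglongrightarrow> 0" for x
  proof -
    have "(\<lambda>n. circlepath 0 (s n) x) \<longlonglongrightarrow> circlepath 0 1 x"
      unfolding circlepath by (intro tendsto_add tendsto_mult tendsto_of_real s_lim tendsto_const)
    then have "(\<lambda>n. D (circlepath 0 (s n) x)) \<longlonglongrightarrow> D (circlepath 0 1 x)"
      by (rule continuous_on_tendsto_compose[OF contD])
         (use in_cball in \<open>auto simp: circlepath norm_mult\<close>)
    moreover have "D (circlepath 0 1 x) = 0"
      by (simp add: D_def circle circlepath)
    ultimately show ?thesis by simp
  qed
  have "(\<lambda>n. integral {0..1} (\<lambda>x. D (circlepath 0 (s n) x))) \<longlonglongrightarrow> integral {0..1} (\<lambda>x::real. 0::real)"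
    by (rule dominated_convergence(2)[where h = "\<lambda>_. B"])
       (use mean B in_cball conv in \<open>auto intro: has_integral_integrable\<close>)
  then have "(\<lambda>n. (\<Sum>t. (cmod (b t))\<^sup>2 * s n^(2*t)) - Re (K 0)) \<longlonglongrightarrow> 0"
    using mean[THEN integral_unique] by simp
  moreover have "(\<lambda>n. \<Sum>t. (cmod (b t))\<^sup>2 * s n^(2*t)) \<longlonglongrightarrow> (\<Sum>t. (cmod (b t))\<^sup>2)"
  proof (rule tannerys_theorem[THEN conjunct2, THEN conjunct2])
    show "(\<lambda>n. (cmod (b t))\<^sup>2 * s n^(2*t)) \<longlonglongrightarrow> (cmod (b t))\<^sup>2" for t
      using s_lim by (auto intro!: tendsto_eq_intros)
    have "norm ((cmod (b t))\<^sup>2 * s n^(2*t)) \<le> (cmod (b t))\<^sup>2" for t n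
      using s[of n] by (auto simp: abs_mult intro!: mult_right_le_one_le power_le_one)
    then show "\<forall>\<^sub>F (t, n) in sequentially \<times>\<^sub>F sequentially.
        norm ((cmod (b t))\<^sup>2 * s n^(2*t)) \<le> (cmod (b t))\<^sup>2"
      by (intro always_eventually) auto
  qed (use b(2) in auto)
  ultimately have "(\<Sum>t. (cmod (b t))\<^sup>2) - Re (K 0) = 0"
    by (intro LIMSEQ_unique[OF tendsto_diff[OF _ tendsto_const]])
  then show ?thesis by simp
qed

subsection \<open>The squared norm of the reflection coefficient\<close>

fun pellT pellU :: "nat \<Rightarrow> real" where
  "pellT 0 = 1"
| "pellU 0 = 0"
| "pellT (Suc n) = 3 * pellT n + 8 * pellU n"
| "pellU (Suc n) = pellT n + 3 * pellU n"

text \<open>The pair encodes \<open>pellT n + pellU n * sqrt 8\<close> =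
  \<open>(3 + sqrt 8) ^ n\<close>, and 3 + \<open>sqrt 8\<close> has norm 1.\<close>

lemma pell_equation: "(pellT n)\<^sup>2 - 8 * (pellU n)\<^sup>2 = 1"
  by (induction n) (simp_all add: power2_eq_square algebra_simps)

lemma pell_lower_bounds: "3 ^ n \<le> pellT n" "0 \<le> pellU n"
proof (induction n)
  case (Suc n)
  { case 1 then show ?case using Suc by simp }
  {
    case 2
    have "0 \<le> (3::real) ^ n" by simp
    then have "0 \<le> pellT n + 3 * pellU n" using Suc by linarith
    then show ?case by simp
  }
qed simp_all

lemma pellT_pos: "0 < pellT n"
  using pell_lower_bounds(1)[of n] zero_less_power[of "3::real" n] by linarith

text \<open>By the Pell equation the squared ratio is (1 - 1/T^2)/2, and T grows at least like
  3^n.\<close>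

lemma pell_ratio_tendsto: "(\<lambda>n. 2 * pellU n / pellT n) \<longlonglongrightarrow> 1 / sqrt 2"
proof -
  have "(\<lambda>n. inverse (pellT n)) \<longlonglongrightarrow> 0"
  proof (rule tendsto_sandwich[of "\<lambda>_. 0" _ _ "\<lambda>n. inverse (3 ^ n)"])
    show "\<forall>\<^sub>F n in sequentially. inverse (pellT n) \<le> inverse (3 ^ n)"
      using pell_lower_bounds(1) by (intro always_eventually allI le_imp_inverse_le) auto
    show "(\<lambda>n. inverse (3 ^ n :: real)) \<longlonglongrightarrow> 0"
      by (rule LIMSEQ_inverse_realpow_zero) simp
  qed (use pellT_pos in \<open>auto intro: always_eventually less_imp_le\<close>)
  then have "(\<lambda>n. sqrt ((1 - (inverse (pellT n))\<^sup>2) / 2)) \<longlonglongrightarrow> sqrt ((1 - 0\<^sup>2) / 2)"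
    by (intro tendsto_intros) auto
  moreover have "sqrt ((1 - (inverse (pellT n))\<^sup>2) / 2) = 2 * pellU n / pellT n" for n
  proof (rule real_sqrt_unique)
    show "(2 * pellU n / pellT n)\<^sup>2 = (1 - (inverse (pellT n))\<^sup>2) / 2"
      using pell_equation[of n] pellT_pos[of n]
      by (simp add: power_divide power_inverse power_mult_distrib divide_simps)
    show "0 \<le> 2 * pellU n / pellT n"
      using pellT_pos[of n] pell_lower_bounds(2)[of n] by simp
  qed
  ultimately show ?thesis by (simp add: real_sqrt_divide)
qed

text \<open>At a root of the quadratic, one site acts on the coordinates (T, U) as multiplication by
  3 + \<open>sqrt 8\<close>, apart from the factor \<open>- z\<close>.\<close>

lemma poly_at_pell_point:
  assumes z: "3 * z\<^sup>2 - 2 * z + 3 = 0"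
  shows "poly (refl_den n) z = (- z) ^ n * (z - 1) * of_real (pellT n)"
    and "poly (refl_num n) z = (- z) ^ n * (- 2 * (1 + z)) * of_real (pellU n)"
proof (induction n)
  case 0
  { case 1 show ?case by simp }
  { case 2 show ?case by simp }
next
  case (Suc n)
  have z1: "z - 1 \<noteq> 0" using z by auto
  {
    case 1
    have "(z - 1) * poly (refl_den (Suc n)) z
        = (z - 1) * ((- z) ^ Suc n * (z - 1) * of_real (pellT (Suc n)))"
    proof -
      have "(3 + z) * (c * (z - 1) * t) - 2 * z * (1 + z) * (c * (- 2 * (1 + z)) * u)
          = (z - 1) * (- z * c * (z - 1) * (3 * t + 8 * u))" for c t u
        using z by algebra
      then show ?thesis
        unfolding transfer Suc power_Suc pellT.simps of_real_add of_real_mult of_real_numeral .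
    qed
    then show ?case by (rule mult_left_cancel[OF z1, THEN iffD1])
  }
  {
    case 2
    have "(z - 1) * poly (refl_num (Suc n)) z
        = (z - 1) * ((- z) ^ Suc n * (- 2 * (1 + z)) * of_real (pellU (Suc n)))"
    proof -
      have "2 * z * (1 + z) * (c * (z - 1) * t) - z\<^sup>2 * (3 * z + 1) * (c * (- 2 * (1 + z)) * u)
          = (z - 1) * (- z * c * (- 2 * (1 + z)) * (t + 3 * u))" for c t u
        using z by algebra
      then show ?thesis
        unfolding transfer Suc power_Suc pellU.simps of_real_add of_real_mult of_real_numeral .
    qed
    then show ?case by (rule mult_left_cancel[OF z1, THEN iffD1])
  }
qed

section \<open>The reflection coefficient on the unit circle\<close>

lemma poly_refl_num_eq_refl_den_at_1: "poly (refl_num n) 1 = poly (refl_den n) 1"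
  by (induction n rule: refl_den.induct) (simp_all add: poly_refl_den_rec poly_refl_num_rec)

text \<open>At 1 the recursion reads x'' = -10 x' - x, so the values alternate in sign and strictly
  grow in modulus; \<open>y\<close> and \<open>x\<close> are consecutive moduli.\<close>

lemma poly_refl_den_at_1_neq_0: "poly (refl_den (Suc n)) 1 \<noteq> 0"
proof -
  have "\<exists>x y :: real. 0 \<le> y \<and> y < x \<and> poly (refl_den n) 1 = - ((- 1) ^ n * of_real y) \<and>
      poly (refl_den (Suc n)) 1 = (- 1) ^ n * of_real x"
  proof (induction n)
    case 0
    show ?case by (rule exI[of _ 4], rule exI[of _ 0]) simp
  next
    case (Suc n)
    then obtain x y :: real where xy: "0 \<le> y" "y < x"
      "poly (refl_den n) 1 = - ((- 1) ^ n * of_real y)" "poly (refl_den (Suc n)) 1 = (- 1) ^ n * of_real x"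
      by blast
    show ?case
      by (rule exI[of _ "10 * x - y"], rule exI[of _ x])
         (use xy in \<open>simp add: poly_refl_den_rec algebra_simps\<close>)
  qed
  then show ?thesis by auto
qed

text \<open>Away from 1, a zero would make the conserved flux negative or zero, whereas it equals
  \<open>(cmod (z - 1))\<^sup>2\<close>.\<close>

lemma poly_refl_den_circle_neq_0:
  assumes "cmod z = 1"
  shows "poly (refl_den (Suc n)) z \<noteq> 0"
proof (cases "z = 1")
  case True
  then show ?thesis using poly_refl_den_at_1_neq_0 by simp
next
  case False
  show ?thesis
  proof
    assume "poly (refl_den (Suc n)) z = 0"
    then have "- of_real ((cmod (poly (refl_num (Suc n)) z))\<^sup>2) = complex_of_real ((cmod (z - 1))\<^sup>2)"
      using invariant_forms(1)[OF assms False, of "Suc n"] by (simp only: complex_norm_square) simp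
    then have "- ((cmod (poly (refl_num (Suc n)) z))\<^sup>2) = (cmod (z - 1))\<^sup>2"
      by (simp only: of_real_minus[symmetric] of_real_eq_iff)
    moreover have "0 < (cmod (z - 1))\<^sup>2" using False by simp
    ultimately show False using zero_le_power2[of "cmod (poly (refl_num (Suc n)) z)"] by linarith
  qed
qed

text \<open>This is the second invariant form divided by the squared modulus of the denominator; at
  1 it holds because \<open>p = q\<close>.\<close>

lemma Re_reflection_circle:
  fixes n :: nat and z :: complex
  assumes z: "cmod z = 1"
  defines "f \<equiv> poly (refl_num (Suc n)) z / poly (refl_den (Suc n)) z"
  shows "4 * Re f = (6 * Re z - 2) * (cmod f)\<^sup>2"
proof -
  define q p where "q = poly (refl_den (Suc n)) z" and "p = poly (refl_num (Suc n)) z"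
  have q: "q \<noteq> 0" using poly_refl_den_circle_neq_0[OF z] by (simp add: q_def)
  have "2 * (q * cnj p + cnj q * p) = (3 * (z + cnj z) - 2) * (p * cnj p)"
  proof (cases "z = 1")
    case True
    then have "p = q" using poly_refl_num_eq_refl_den_at_1 by (simp add: p_def q_def)
    then show ?thesis using True by (simp add: algebra_simps)
  next
    case False
    then show ?thesis using invariant_forms(2)[OF z False] by (simp add: q_def p_def)
  qed
  then have "2 * (f + cnj f) = (3 * (z + cnj z) - 2) * (f * cnj f)"
    using q by (simp add: f_def flip: q_def p_def) (simp add: field_simps)
  then have "complex_of_real (4 * Re f) = of_real ((6 * Re z - 2) * (cmod f)\<^sup>2)"
    unfolding complex_add_cnj by (simp add: complex_norm_square flip: complex_norm_square)
  then show ?thesis by (simp only: of_real_eq_iff)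
qed

lemma quadratic_divides:
  fixes X :: "complex poly"
  assumes "\<And>z. 3 * z\<^sup>2 - 2 * z + 3 = 0 \<Longrightarrow> poly X z = 0"
  obtains k where "\<And>z. poly X z = (3 * z\<^sup>2 - 2 * z + 3) * poly k z"
proof -
  define w where "w = (1 + 2 * of_real (sqrt 2) * \<i>) / 3"
  define w' where "w' = (1 - 2 * of_real (sqrt 2) * \<i>) / 3"
  have s2: "complex_of_real (sqrt 2) * of_real (sqrt 2) = 2"
    by (simp flip: of_real_mult)
  have sum: "w + w' = 2 / 3" by (simp add: w_def w'_def field_simps)
  have prod: "w * w' = 1" using s2 by (simp add: w_def w'_def field_simps)
  have fact: "3 * z\<^sup>2 - 2 * z + 3 = 3 * ((z - w) * (z - w'))" for z
    using sum prod by algebra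
  have ne: "w \<noteq> w'" by (simp add: w_def w'_def complex_eq_iff)
  have "poly X w = 0" "poly X w' = 0" by (auto intro!: assms simp: fact)
  then obtain Y where Y: "X = [:- w, 1:] * Y" by (metis dvdE poly_eq_0_iff_dvd)
  with \<open>poly X w' = 0\<close> ne have "poly Y w' = 0" by auto
  then obtain V where V: "Y = [:- w', 1:] * V" by (metis dvdE poly_eq_0_iff_dvd)
  show ?thesis
    by (rule that[of "smult (1/3) V"]) (simp only: fact Y V poly_mult poly_smult, simp add: algebra_simps)
qed

lemma suminf_norm_sq_reflection:
  assumes b: "\<And>t. cmod (b t) \<le> 1" "summable (\<lambda>t. (cmod (b t))\<^sup>2)"
    and disc: "\<And>z. cmod z < 1 \<Longrightarrow> poly (refl_den (Suc n)) z \<noteq> 0"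
    and gen: "\<And>z. cmod z < 1 \<Longrightarrow> (\<lambda>t. b t * z^t) sums (poly (refl_num (Suc n)) z / poly (refl_den (Suc n)) z)"
  shows "(\<Sum>t. (cmod (b t))\<^sup>2) = 2 * pellU (Suc n) / pellT (Suc n)"
proof -
  define q p where "q = refl_den (Suc n)" and "p = refl_num (Suc n)"
  define P where "P = 2 * pellU (Suc n) / pellT (Suc n)"
  have P: "P * pellT (Suc n) = 2 * pellU (Suc n)"
    using pellT_pos[of "Suc n"] by (simp add: P_def del: pellT.simps pellU.simps)
  \<comment> \<open>\<open>X\<close> is the numerator of the function K. At the roots of the
    quadratic it is a multiple of \<open>P * pellT (Suc n) - 2 * pellU (Suc n)\<close>, which fixes
    \<open>P\<close>.\<close>
  define X where "X = [:0, 4:] * p - smult (3 * of_real P) ([:- 1, 0, 1:] * q)"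
  have X: "poly X z = 4 * z * poly p z - 3 * of_real P * (z\<^sup>2 - 1) * poly q z" for z
    by (simp add: X_def algebra_simps power2_eq_square)
  have "poly X z = 0" if z: "3 * z\<^sup>2 - 2 * z + 3 = 0" for z
  proof -
    have "4 * z * (c * (- 2 * (1 + z)) * u) - 3 * r * (z\<^sup>2 - 1) * (c * (z - 1) * t)
        = c * (1 + z) * (4 * z) * (r * t - 2 * u)" for c r t u
      using z by algebra
    then have "poly X z = (- z) ^ Suc n * (1 + z) * (4 * z) * of_real (P * pellT (Suc n) - 2 * pellU (Suc n))"
      unfolding X p_def q_def poly_at_pell_point[OF z] of_real_diff of_real_mult of_real_numeral .
    then show ?thesis unfolding P by simp
  qed
  then obtain k where k: "\<And>z. poly X z = (3 * z\<^sup>2 - 2 * z + 3) * poly k z"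
    using quadratic_divides by blast
  define F where "F z = poly p z / poly q z" for z
  define K where "K z = poly k z / poly q z" for z
  have q: "poly q z \<noteq> 0" if "cmod z \<le> 1" for z
    using disc[of z] poly_refl_den_circle_neq_0[of z n] that by (cases "cmod z = 1") (auto simp: q_def)
  have KF: "(3 * z\<^sup>2 - 2 * z + 3) * K z = 4 * z * F z - 3 * of_real P * (z\<^sup>2 - 1)"
    if "cmod z \<le> 1" for z
    using k[of z, unfolded X] q[OF that] by (simp add: K_def F_def field_simps)
  have contF: "continuous_on (cball 0 1) F" and contK: "continuous_on (cball 0 1) K"
    unfolding F_def K_def using q by (auto intro!: continuous_intros)
  have generic: "(cmod (F z))\<^sup>2 = Re (K z)" if z: "cmod z = 1" "Re z \<noteq> 1 / 3" for z
  proof -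
    have zz: "z * cnj z = 1"
      using z(1) by (simp add: complex_norm_square[symmetric])
    \<comment> \<open>Multiplying by \<open>cnj z\<close> makes the quadratic real and turns
      \<open>z\<^sup>2 - 1\<close> into the imaginary \<open>z - cnj z\<close>, so \<open>P\<close>
      drops out of the real part.\<close>
    have "of_real (6 * Re z - 2) * K z = cnj z * ((3 * z\<^sup>2 - 2 * z + 3) * K z)"
      using zz complex_add_cnj[of z] by (simp, algebra)
    also have "\<dots> = 4 * F z - 3 * of_real P * (z - cnj z)"
    proof -
      have "cmod z \<le> 1" using z(1) by simp
      show ?thesis unfolding KF[OF \<open>cmod z \<le> 1\<close>] using zz by algebra
    qed
    finally have "Re (of_real (6 * Re z - 2) * K z) = Re (4 * F z - 3 * of_real P * (z - cnj z))"
      by (rule arg_cong)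
    then have "(6 * Re z - 2) * Re (K z) = 4 * Re (F z)"
      by simp
    also have "\<dots> = (6 * Re z - 2) * (cmod (F z))\<^sup>2"
      using Re_reflection_circle[OF z(1), of n] by (simp add: F_def p_def q_def)
    finally show ?thesis using z(2) by simp
  qed
  have circle: "(cmod (F z))\<^sup>2 = Re (K z)" if z: "cmod z = 1" for z
  proof (cases "Re z = 1 / 3")
    case True
    \<comment> \<open>Here \<open>6 * Re z - 2\<close> vanishes and cannot be cancelled. The
      identity extends by continuity: \<open>C\<close> is closed and contains the circle up to the
      finite set \<open>E\<close>, and the circle has no isolated points.\<close>
    define C where "C = {z \<in> sphere 0 1. (cmod (F z))\<^sup>2 - Re (K z) = 0}"
    define E where "E = {z. cmod z = 1 \<and> Re z = 1 / 3}"
    have "closed C"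
      unfolding C_def
      by (rule continuous_closed_preimage_constant)
         (auto intro!: continuous_intros continuous_on_subset[OF contF] continuous_on_subset[OF contK])
    have "E \<subseteq> {z. poly [:3, - 2, 3:] z = 0}"
    proof
      fix z assume "z \<in> E"
      then have zE: "cmod z = 1" "Re z = 1 / 3" by (auto simp: E_def)
      have "z * cnj z = 1"
        using zE(1) by (simp add: complex_norm_square[symmetric])
      moreover have "z + cnj z = 2 / 3"
        unfolding complex_add_cnj zE(2) by simp
      ultimately have "3 * z\<^sup>2 - 2 * z + 3 = 0" by algebra
      then show "z \<in> {z. poly [:3, - 2, 3:] z = 0}"
        by (simp add: algebra_simps power2_eq_square)
    qed
    then have "finite E"
      by (rule finite_subset) (rule poly_roots_finite, simp)
    have "z islimpt sphere 0 1"
    proof (rule connected_imp_perfect)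
      show "connected (sphere (0::complex) 1)" by (rule connected_sphere) simp
      show "sphere (0::complex) 1 \<noteq> {x}" for x
      proof
        assume "sphere (0::complex) 1 = {x}"
        moreover have "1 \<in> sphere (0::complex) 1" "-1 \<in> sphere (0::complex) 1" by auto
        ultimately show False by auto
      qed
    qed (use z in auto)
    moreover have "sphere 0 1 \<subseteq> E \<union> C"
    proof
      fix x :: complex assume x: "x \<in> sphere 0 1"
      then show "x \<in> E \<union> C"
        using generic[of x] by (cases "Re x = 1 / 3") (auto simp: E_def C_def)
    qed
    ultimately have "z islimpt E \<union> C" by (rule islimpt_subset)
    then have "z islimpt C" using islimpt_Un_finite[OF \<open>finite E\<close>] by blast
    then have "z \<in> C" using \<open>closed C\<close> closed_limpt by blast
    then show ?thesis by (simp add: C_def)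
  qed (use generic z in auto)
  have "(\<Sum>t. (cmod (b t))\<^sup>2) = Re (K 0)"
  proof (rule suminf_norm_sq_coeffs[OF contF _ contK _ b circle])
    show "(\<lambda>t. b t * z^t) sums F z" if "cmod z < 1" for z
      using gen[OF that] by (simp add: F_def p_def q_def)
    show "K holomorphic_on ball 0 1"
      unfolding K_def using q by (auto intro!: holomorphic_intros)
  qed
  also have "K 0 = of_real P" using KF[of 0] by simp
  finally show ?thesis by (simp add: P_def)
qed

subsection \<open>The generating functions of the absorbed walk\<close>

definition walk :: "nat \<Rightarrow> nat \<Rightarrow> wave" where
  "walk N t = ((\<lambda>\<phi>. proj_no (int N) (proj_no (- 1) (evol \<phi>))) ^^ t) (start 0 0 1)"

text \<open>
  \<open>arrive\<close> is the state before the two measurements, so it still carries the amplitudes about to be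
  absorbed at the boundaries.
\<close>

definition arrive :: "nat \<Rightarrow> nat \<Rightarrow> wave" where
  "arrive N t = (case t of 0 \<Rightarrow> start 0 0 1 | Suc k \<Rightarrow> evol (walk N k))"

lemma walk_Suc: "walk N (Suc t) = proj_no (int N) (proj_no (- 1) (evol (walk N t)))"
  by (simp add: walk_def)

lemma evol_apply: "evol \<psi> (m, c) = (\<Sum>d\<in>UNIV. grover c d * \<psi> (m - step_of c, d))"
  by (simp add: evol_def shift_def coin_op_def)

lemma proj_no_apply: "proj_no n \<psi> (m, c) = (if m = n then 0 else \<psi> (m, c))"
  by (simp add: proj_no_def proj_yes_def)

lemma walk_arrive: "1 \<le> N \<Longrightarrow> walk N t (m, c) = (if 0 \<le> m \<and> m < int N then arrive N t (m, c) else 0)"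
proof (induction t arbitrary: m c)
  case 0
  then show ?case by (auto simp: walk_def arrive_def start_def ket_def)
next
  case (Suc t)
  \<comment> \<open>The projections clear only the two boundary sites; nothing lies beyond them
    because a step moves by at most one site.\<close>
  have "evol (walk N t) (m, c) = 0" if "m < -1 \<or> m > int N"
    using that Suc by (cases c) (auto simp: evol_apply)
  then show ?case by (auto simp: walk_Suc proj_no_apply arrive_def)
qed

section \<open>Boundedness of the amplitudes\<close>

lemma l2_norm_nonneg: "0 \<le> l2_norm \<psi>"
  by (simp add: l2_norm_def infsum_nonneg)

lemma l2_norm_proj_no_le:
  assumes "\<psi> \<in> l2"
  shows "l2_norm (proj_no n \<psi>) \<le> l2_norm \<psi>"
proof (rule power2_le_imp_le)
  show "(l2_norm (proj_no n \<psi>))\<^sup>2 \<le> (l2_norm \<psi>)\<^sup>2"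
    using proj_pythagoras[OF assms, of n] zero_le_power2[of "l2_norm (proj_yes n \<psi>)"] by linarith
qed (rule l2_norm_nonneg)

lemma walk_l2: "walk N t \<in> l2 \<and> l2_norm (walk N t) \<le> 1"
proof (induction t)
  case 0
  have "l2_norm (start 0 0 1) \<le> 1"
    by (rule power2_le_imp_le) (simp_all add: l2_norm_start)
  then show ?case
    by (simp add: walk_def l2_start)
next
  case (Suc t)
  have e: "evol (walk N t) \<in> l2" using Suc by (simp add: l2_evol)
  have "l2_norm (walk N (Suc t)) \<le> l2_norm (evol (walk N t))"
    unfolding walk_Suc using l2_norm_proj_no_le[OF l2_proj_no[OF e]] l2_norm_proj_no_le[OF e] by (rule order_trans)
  moreover have "walk N (Suc t) \<in> l2"
    unfolding walk_Suc by (intro l2_proj_no e)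
  ultimately show ?case
    using Suc evol_isometry[of "walk N t"] by simp
qed

lemma cmod_le_l2_norm:
  assumes "\<psi> \<in> l2"
  shows "cmod (\<psi> x) \<le> l2_norm \<psi>"
proof (rule power2_le_imp_le)
  have "(\<Sum>\<^sub>\<infinity>x\<in>{x}. (cmod (\<psi> x))\<^sup>2) \<le> (\<Sum>\<^sub>\<infinity>x. (cmod (\<psi> x))\<^sup>2)"
    by (rule infsum_mono_neutral) (use assms in \<open>auto simp: l2_def\<close>)
  then show "(cmod (\<psi> x))\<^sup>2 \<le> (l2_norm \<psi>)\<^sup>2"
    by (simp add: l2_normsq)
qed (rule l2_norm_nonneg)

lemma cmod_arrive_le_1: "cmod (arrive N t x) \<le> 1"
proof (cases t)
  case 0
  then show ?thesis by (simp add: arrive_def start_def ket_def)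
next
  case (Suc k)
  have "cmod (evol (walk N k) x) \<le> l2_norm (evol (walk N k))"
    using walk_l2[of N k] by (intro cmod_le_l2_norm l2_evol) auto
  also have "\<dots> \<le> 1" using walk_l2[of N k] evol_isometry[of "walk N k"] by simp
  finally show ?thesis by (simp add: Suc arrive_def)
qed

section \<open>Scattering relations for the generating functions\<close>

definition gen :: "nat \<Rightarrow> complex \<Rightarrow> wave" where
  "gen N z x = (\<Sum>t. arrive N t x * z ^ t)"

lemma gen_sums: "cmod z < 1 \<Longrightarrow> (\<lambda>t. arrive N t x * z ^ t) sums gen N z x"
  unfolding gen_def
  by (rule summable_sums, rule summable_comparison_test'[OF summable_geometric[of "cmod z"]])
     (auto simp: norm_mult norm_power cmod_arrive_le_1 mult_left_le_one_le)

text \<open>The time shift becomes the factor \<open>z\<close> and the initial state the source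
  term. The condition on the site encodes that absorbed amplitudes do not propagate.\<close>

lemma gen_step:
  assumes z: "cmod z < 1" and N: "1 \<le> N"
  shows "gen N z (m, c) = start 0 0 1 (m, c) + z * (\<Sum>d\<in>UNIV. grover c d *
    (if 0 \<le> m - step_of c \<and> m - step_of c < int N then gen N z (m - step_of c, d) else 0))"
proof -
  let ?m = "m - step_of c"
  have "(\<lambda>t. walk N t (?m, d) * z ^ t) sums
      (if 0 \<le> ?m \<and> ?m < int N then gen N z (?m, d) else 0)" for d
    using gen_sums[OF z, of N "(?m, d)"]
    by (cases "0 \<le> ?m \<and> ?m < int N") (simp_all only: walk_arrive[OF N] simp_thms if_True if_False mult_zero_left sums_zero)
  then have "(\<lambda>t. \<Sum>d\<in>UNIV. z * grover c d * (walk N t (?m, d) * z ^ t)) sums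
      (\<Sum>d\<in>UNIV. z * grover c d * (if 0 \<le> ?m \<and> ?m < int N then gen N z (?m, d) else 0))"
    by (intro sums_sum sums_mult)
  moreover have "arrive N (Suc t) (m, c) * z ^ Suc t =
      (\<Sum>d\<in>UNIV. z * grover c d * (walk N t (?m, d) * z ^ t))" for t
    by (simp add: arrive_def evol_apply sum_distrib_left sum_distrib_right mult_ac)
  ultimately have "(\<lambda>t. arrive N (Suc t) (m, c) * z ^ Suc t) sums
      (z * (\<Sum>d\<in>UNIV. grover c d * (if 0 \<le> ?m \<and> ?m < int N then gen N z (?m, d) else 0)))"
    by (simp only: sum_distrib_left mult.assoc)
  then have "(\<lambda>t. arrive N t (m, c) * z ^ t) sums
      (z * (\<Sum>d\<in>UNIV. grover c d * (if 0 \<le> ?m \<and> ?m < int N then gen N z (?m, d) else 0))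
        + arrive N 0 (m, c) * z ^ 0)"
    by (rule sums_Suc)
  with gen_sums[OF z, of N "(m, c)"] show ?thesis
    by (simp add: sums_unique2 arrive_def add.commute)
qed

text \<open>The shift in \<open>b\<close> puts \<open>a m\<close> and \<open>b m\<close> on the same
  edge, between \<open>m - 1\<close> and \<open>m\<close>. Eliminating the resting amplitude
  \<open>s\<close> leaves a scatterer with reflection 2z(1 + z)/(3 + z) and transmission z(z - 1)/(3
  + z).\<close>

lemma gen_site:
  assumes z: "cmod z < 1" and N: "1 \<le> N" and m: "0 \<le> m" "m < int N"
  defines "a \<equiv> \<lambda>m. gen N z (m, cR)" and "b \<equiv> \<lambda>m. gen N z (m - 1, cL)"
  shows "(3 + z) * a (m + 1) = 2 * z * (1 + z) * b (m + 1) + z * (z - 1) * a m"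
    and "(3 + z) * b m = z * (z - 1) * b (m + 1) + 2 * z * (1 + z) * a m"
proof -
  define s where "s = gen N z (m, cS)"
  note step = gen_step[OF z N]
  have "s = z * (2 / 3 * b (m + 1) - 1 / 3 * s + 2 / 3 * a m)"
    unfolding s_def a_def b_def
    by (rule trans[OF step]) (use m in \<open>simp add: start_def ket_def UNIV_coin grover_def\<close>)
  then have S: "3 * s = z * (2 * b (m + 1) - s + 2 * a m)" by algebra
  have "a (m + 1) = z * (2 / 3 * b (m + 1) + 2 / 3 * s - 1 / 3 * a m)"
    unfolding s_def a_def b_def
    by (rule trans[OF step]) (use m in \<open>simp add: start_def ket_def UNIV_coin grover_def\<close>)
  then have R: "3 * a (m + 1) = z * (2 * b (m + 1) + 2 * s - a m)" by algebra
  have "b m = z * (- 1 / 3 * b (m + 1) + 2 / 3 * s + 2 / 3 * a m)"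
    unfolding s_def a_def b_def
    by (rule trans[OF step]) (use m in \<open>simp add: start_def ket_def UNIV_coin grover_def\<close>)
  then have L: "3 * b m = z * (- b (m + 1) + 2 * s + 2 * a m)" by algebra
  show "(3 + z) * a (m + 1) = 2 * z * (1 + z) * b (m + 1) + z * (z - 1) * a m"
    using S R by algebra
  show "(3 + z) * b m = z * (z - 1) * b (m + 1) + 2 * z * (1 + z) * a m"
    using S L by algebra
qed

lemma gen_boundary:
  assumes "cmod z < 1" "1 \<le> N"
  shows "gen N z (0, cR) = 1" "gen N z (int N - 1, cL) = 0"
  using gen_step[OF assms, of 0 cR] gen_step[OF assms, of "int N - 1" cL]
  by (auto simp: start_def ket_def)

text \<open>Nothing enters from the right, so the data at \<open>N\<close> are \<open>A\<close> and
  0; the transfer matrix carries them \<open>j\<close> sites to the left. The power of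
  \<open>z\<close> and the one remaining \<open>z - 1\<close> clear the transmission
  factors.\<close>

lemma gen_poly:
  assumes z: "cmod z < 1" and N: "1 \<le> N" and "j \<le> N"
  defines "A \<equiv> gen N z (int N, cR)"
  shows "z ^ j * (z - 1) * gen N z (int N - int j, cR) = A * poly (refl_den j) z \<and>
    z ^ j * (z - 1) * gen N z (int N - int j - 1, cL) = A * poly (refl_num j) z"
  using \<open>j \<le> N\<close>
proof (induction j)
  case 0
  then show ?case using gen_boundary[OF z N] by (simp add: A_def)
next
  case (Suc j)
  define m where "m = int N - int (Suc j)"
  have m: "0 \<le> m" "m < int N" and j: "int N - int j = m + 1"
    using Suc.prems by (simp_all add: m_def)
  define a a' b b' where "a = gen N z (m, cR)" and "a' = gen N z (m + 1, cR)"
    and "b = gen N z (m - 1, cL)" and "b' = gen N z (m, cL)"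
  note ab = this
  have site: "(3 + z) * a' = 2 * z * (1 + z) * b' + z * (z - 1) * a"
    "(3 + z) * b = z * (z - 1) * b' + 2 * z * (1 + z) * a"
    using gen_site[OF z N m] by (simp_all only: ab add_diff_cancel_right')
  have "z ^ j * (z - 1) * a' = A * poly (refl_den j) z \<and> z ^ j * (z - 1) * b' = A * poly (refl_num j) z"
    using Suc.IH Suc.prems unfolding j by (simp only: ab add_diff_cancel_right' Suc_leD)
  then have IH: "z ^ j * (z - 1) * a' = A * poly (refl_den j) z" "z ^ j * (z - 1) * b' = A * poly (refl_num j) z"
    by blast+
  have z1: "z - 1 \<noteq> 0" "3 + z \<noteq> 0"
    using z norm_triangle_ineq2[of 3 "- z"] by auto
  have "(z - 1) * (z ^ Suc j * (z - 1) * a) = (z - 1) * (A * poly (refl_den (Suc j)) z)"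
  proof -
    have "(z - 1) * (z * w * (z - 1) * a) = A * ((3 + z) * q - 2 * z * (1 + z) * p)"
      if "w * (z - 1) * a' = A * q" "w * (z - 1) * b' = A * p" for w q p
      using site(1) that by algebra
    from this[OF IH] transfer(1)[of z j] show ?thesis by (simp add: mult.left_commute)
  qed
  moreover have "(z - 1) * (z ^ Suc j * (z - 1) * b) = (z - 1) * (A * poly (refl_num (Suc j)) z)"
  proof -
    \<comment> \<open>The relation for \<open>b\<close> still contains \<open>a\<close>; eliminating
      it costs the factor \<open>3 + z\<close>, which is nonzero in the disc.\<close>
    have "(3 + z) * ((z - 1) * (z * w * (z - 1) * b)) =
        (3 + z) * (A * (2 * z * (1 + z) * q - z\<^sup>2 * (3 * z + 1) * p))"
      if "w * (z - 1) * a' = A * q" "w * (z - 1) * b' = A * p" for w q p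
      using site that by algebra
    from mult_left_cancel[OF z1(2), THEN iffD1, OF this[OF IH]] show ?thesis
      unfolding transfer(2)[symmetric] power_Suc by (simp only: mult.left_commute[of A])
  qed
  ultimately show ?case
    unfolding mult_left_cancel[OF z1(1)] by (simp only: ab m_def)
qed

text \<open>For \<open>z\<close> \<noteq> 0 the unit input at site 0 gives
  \<open>A * poly (refl_den (Suc n)) z = z ^ Suc n * (z - 1)\<close>, which is nonzero. This yields
  both the absence of poles in the disc and the quotient.\<close>

lemma gen_exit:
  assumes z: "cmod z < 1"
  shows "poly (refl_den (Suc n)) z \<noteq> 0"
    and "gen (Suc n) z (- 1, cL) = poly (refl_num (Suc n)) z / poly (refl_den (Suc n)) z"
proof -
  have z1: "z \<noteq> 1" using z by auto
  have *: "poly (refl_den (Suc n)) z \<noteq> 0 \<and>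
      gen (Suc n) z (- 1, cL) = poly (refl_num (Suc n)) z / poly (refl_den (Suc n)) z"
  proof (cases "z = 0")
    case True
    have "poly (refl_den (Suc n)) 0 \<noteq> 0"
      by (induction n) (simp_all add: poly_refl_den_rec)
    moreover have "poly (refl_num (Suc n)) 0 = 0"
      by (induction n rule: refl_num.induct) (simp_all add: poly_refl_num_rec)
    moreover have "gen (Suc n) 0 (- 1, cL) = 0"
      using gen_step[of 0 "Suc n" "- 1" cL] by (simp add: start_def ket_def)
    ultimately show ?thesis using True by simp
  next
    case False
    define A where "A = gen (Suc n) z (int (Suc n), cR)"
    have "z ^ Suc n * (z - 1) * gen (Suc n) z (0, cR) = A * poly (refl_den (Suc n)) z \<and>
      z ^ Suc n * (z - 1) * gen (Suc n) z (- 1, cL) = A * poly (refl_num (Suc n)) z"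
      using gen_poly[OF z _ le_refl, of "Suc n"] by (simp only: diff_self diff_0 A_def le_add1 Suc_eq_plus1_left)
    moreover have start1: "gen (Suc n) z (0, cR) = 1"
      using gen_boundary(1)[OF z] by simp
    ultimately have e: "z ^ Suc n * (z - 1) = A * poly (refl_den (Suc n)) z"
      "z ^ Suc n * (z - 1) * gen (Suc n) z (- 1, cL) = A * poly (refl_num (Suc n)) z"
      unfolding start1 mult_1_right by blast+
    have ne: "A \<noteq> 0" "poly (refl_den (Suc n)) z \<noteq> 0"
      using e(1) False z1 by auto
    then show ?thesis using e(2) unfolding e(1) by (simp add: field_simps)
  qed
  from * show "poly (refl_den (Suc n)) z \<noteq> 0"
    "gen (Suc n) z (- 1, cL) = poly (refl_num (Suc n)) z / poly (refl_den (Suc n)) z" by auto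
qed

section \<open>The absorption probability as a series\<close>

lemma l2_norm_exit:
  assumes N: "1 \<le> N"
  shows "(l2_norm (proj_yes (- 1) (evol (walk N t))))\<^sup>2 = (cmod (arrive N (Suc t) (- 1, cL)))\<^sup>2"
proof -
  \<comment> \<open>Only a left move reaches -1: the other two components would come from -1 or -2,
    where \<open>walk\<close> vanishes.\<close>
  have pt: "(cmod (proj_yes (- 1) (evol (walk N t)) x))\<^sup>2 =
      (if x = (- 1, cL) then (cmod (arrive N (Suc t) (- 1, cL)))\<^sup>2 else 0)" for x
  proof (cases x)
    case (Pair m c)
    then show ?thesis
      by (cases c) (auto simp: proj_yes_def arrive_def evol_apply walk_arrive[OF N])
  qed
  have "(l2_norm (proj_yes (- 1) (evol (walk N t))))\<^sup>2 =
      (\<Sum>\<^sub>\<infinity>x::int \<times> coin. if x = (- 1, cL) then (cmod (arrive N (Suc t) (- 1, cL)))\<^sup>2 else 0)"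
    unfolding l2_normsq by (rule infsum_cong) (rule pt)
  also have "\<dots> = (\<Sum>\<^sub>\<infinity>x\<in>{(- 1, cL) :: int \<times> coin}. (cmod (arrive N (Suc t) (- 1, cL)))\<^sup>2)"
    by (rule infsum_cong_neutral) auto
  finally show ?thesis by simp
qed

lemma left_absorb_sums:
  assumes N: "1 \<le> N"
  shows "(\<lambda>t. (cmod (arrive N t (- 1, cL)))\<^sup>2) sums left_absorb 1 N 0 0 1"
proof -
  define p where "p t = (cmod (arrive N t (- 1, cL)))\<^sup>2" for t
  define f where "f t = (l2_norm (proj_yes (- int 1) (evol (((\<lambda>\<phi>. proj_no (int N)
    (proj_no (- int 1) (evol \<phi>))) ^^ (t - 1)) (start 0 0 1)))))\<^sup>2" for t
  have fp: "f t = p t" if "t \<in> {1..}" for t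
    using that l2_norm_exit[OF N, of "t - 1"] by (simp add: f_def p_def walk_def)
  have "f summable_on {1..}" unfolding f_def by (rule left_absorb_summable)
  moreover have "left_absorb 1 N 0 0 1 = infsum f {1..}"
    unfolding left_absorb_def f_def ..
  ultimately have "(f has_sum left_absorb 1 N 0 0 1) {1..}"
    by (metis has_sum_infsum)
  moreover have "(f has_sum S) {1..} \<longleftrightarrow> (p has_sum S) {1..}" for S
    by (rule has_sum_cong) (rule fp)
  ultimately have "(p has_sum left_absorb 1 N 0 0 1) {1..}" by blast
  moreover have "(p has_sum left_absorb 1 N 0 0 1) UNIV \<longleftrightarrow>
      (p has_sum left_absorb 1 N 0 0 1) {1..}"
  proof (rule has_sum_cong_neutral)
    \<comment> \<open>Only time 0 is added, and the walk then sits at site 0.\<close>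
    show "p t = 0" if "t \<in> UNIV - {1..}" for t
      using that by (cases t) (auto simp: p_def arrive_def start_def ket_def)
  qed auto
  ultimately have "(p has_sum left_absorb 1 N 0 0 1) UNIV" by simp
  then show ?thesis
    unfolding p_def by (rule has_sum_imp_sums)
qed

theorem mainTheorem7:
  shows "(\<lambda>N. left_absorb 1 N 0 0 1) \<longlonglongrightarrow> 1 / sqrt 2"
proof -
  \<comment> \<open>The exact value is derived for \<open>N\<close> \<ge> 1, so the limit is taken
    along \<open>Suc n\<close> and shifted back.\<close>
  have "left_absorb 1 (Suc n) 0 0 1 = 2 * pellU (Suc n) / pellT (Suc n)" for n
  proof -
    define b where "b t = arrive (Suc n) t (- 1, cL)" for t
    have sums: "(\<lambda>t. (cmod (b t))\<^sup>2) sums left_absorb 1 (Suc n) 0 0 1"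
      unfolding b_def by (rule left_absorb_sums) simp
    have "(\<Sum>t. (cmod (b t))\<^sup>2) = 2 * pellU (Suc n) / pellT (Suc n)"
    proof (rule suminf_norm_sq_reflection)
      show "cmod (b t) \<le> 1" for t unfolding b_def by (rule cmod_arrive_le_1)
      show "summable (\<lambda>t. (cmod (b t))\<^sup>2)" using sums by (rule sums_summable)
      show "poly (refl_den (Suc n)) z \<noteq> 0" if "cmod z < 1" for z
        using that by (rule gen_exit)
      show "(\<lambda>t. b t * z ^ t) sums (poly (refl_num (Suc n)) z / poly (refl_den (Suc n)) z)"
        if "cmod z < 1" for z
        unfolding b_def gen_exit(2)[OF that, symmetric] using that by (rule gen_sums)
    qed
    then show ?thesis using sums_unique[OF sums] by (simp only:)
  qed
  then have "(\<lambda>n. left_absorb 1 (Suc n) 0 0 1) \<longlonglongrightarrow> 1 / sqrt 2"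
    using LIMSEQ_Suc[OF pell_ratio_tendsto] by (simp only:)
  then show ?thesis by (rule LIMSEQ_imp_Suc)
qed

end
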